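(* Let $S>0$, let $q\in L^2[-S,S]$ be real valued, let $M=(m_{ij})$ be a real $2\times 2$ matrix with $\det M=1$, and let $\alpha\in[0,\pi)$, $\beta\in(0,\pi]$. Let $m_{\alpha,\beta}(\lambda)$ be the Titchmarsh-Weyl $m$-function (defined in the context) of $-y''+qy=\lambda y$ on $[-S,S]$ with transfer condition $(y(0^+),y'(0^+))^T=M(y(0^-),y'(0^-))^T$ and boundary conditions $y(-S)\cos\alpha-y'(-S)\sin\alpha=0$, $y(S)\cos\beta-y'(S)\sin\beta=0$. Then, as $\lambda\to-\infty$ along the real axis, $$m_{\alpha,\beta}(\lambda)=\begin{cases}-i\sqrt{\lambda}+O(1), & \alpha=0,\\[2pt] \cot\alpha+O\!\left(\dfrac{1}{\sqrt{\lambda}}\right), & \alpha\neq 0,\end{cases}$$ where for $\lambda<0$ one takes $\sqrt{\lambda}=i\sqrt{|\lambda|}$ (so $-i\sqrt\lambda=\sqrt{|\lambda|}>0$).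
   Context: A solution of $-y''+qy=\lambda y$ on $[-S,S]$ with the transfer condition is a function such that $y,y'$ are absolutely continuous on each of $[-S,0)$ and $(0,S]$ (with one-sided limits at $0$), satisfying the differential equation a.e. and $(y(0^+),y'(0^+))^T=M(y(0^-),y'(0^-))^T$. Let $v_\beta(x,\lambda)$ be the solution (obeying the transfer condition) with $v_\beta(S,\lambda)=\sin\beta$, $v_\beta'(S,\lambda)=\cos\beta$. Put $$\Delta_{\alpha,\beta}(\lambda)=v_\beta'(-S,\lambda)\sin\alpha-v_\beta(-S,\lambda)\cos\alpha ,$$ an entire function whose zeros are the eigenvalues of the boundary value problem. The Titchmarsh-Weyl $m$-function is $$m_{\alpha,\beta}(\lambda)=\frac{v_\beta(-S,\lambda)\sin\alpha+v_\beta'(-S,\lambda)\cos\alpha}{\Delta_{\alpha,\beta}(\lambda)} .$$ *)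

theory Defs
  imports "HOL-Analysis.Analysis" "HOL-Library.Landau_Symbols"
begin

(* Absolute continuity in the usual epsilon-delta sense. A division of a set T is a finite
   family of nonempty compact intervals with pairwise disjoint interiors and union T, so D ranges
   over the finite non-overlapping families of compact subintervals of I; the endpoints of a
   member K are Inf K and Sup K. *)
definition absolutely_continuous_on :: "real set \<Rightarrow> (real \<Rightarrow> 'a::real_normed_vector) \<Rightarrow> bool" where
  "absolutely_continuous_on I f \<longleftrightarrow>
     (\<forall>\<epsilon>>0. \<exists>\<delta>>0. \<forall>D T. D division_of T \<and> T \<subseteq> I \<and> (\<Sum>K\<in>D. Sup K - Inf K) < \<delta> \<longrightarrow>
        (\<Sum>K\<in>D. norm (f (Sup K) - f (Inf K))) < \<epsilon>)"

(* The pair (y, y') is a solution of -y'' + q y = l y on one interval I: y' is the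
   derivative of y everywhere on I, one-sided at an endpoint belonging to I. *)
definition sl_solution_on ::
  "real set \<Rightarrow> (real \<Rightarrow> real) \<Rightarrow> complex \<Rightarrow> (real \<Rightarrow> complex) \<Rightarrow> (real \<Rightarrow> complex) \<Rightarrow> bool" where
  "sl_solution_on I q l y y' \<longleftrightarrow>
     absolutely_continuous_on I y \<and>
     absolutely_continuous_on I y' \<and>
     (\<forall>x\<in>I. (y has_vector_derivative y' x) (at x within I)) \<and>
     (AE x in lebesgue. x \<in> I \<longrightarrow>
        (\<exists>y2. (y' has_vector_derivative y2) (at x within I) \<and>
              - y2 + complex_of_real (q x) * y x = l * y x))"

(* The values y 0 and y' 0 play no role: only the one-sided limits at 0 enter. *)
definition transfer_solution ::
  "real \<Rightarrow> (real \<Rightarrow> real) \<Rightarrow> real^2^2 \<Rightarrow> complex \<Rightarrow> (real \<Rightarrow> complex) \<Rightarrow> (real \<Rightarrow> complex) \<Rightarrow> bool" where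
  "transfer_solution S q M l y y' \<longleftrightarrow>
     sl_solution_on {-S..<0} q l y y' \<and>
     sl_solution_on {0<..S} q l y y' \<and>
     (\<exists>ym ym' yp yp'.
        (y \<longlongrightarrow> ym) (at_left 0) \<and> (y' \<longlongrightarrow> ym') (at_left 0) \<and>
        (y \<longlongrightarrow> yp) (at_right 0) \<and> (y' \<longlongrightarrow> yp') (at_right 0) \<and>
        (vector [yp, yp'] :: complex^2) =
          (\<chi> i j. complex_of_real (M $ i $ j)) *v (vector [ym, ym'] :: complex^2))"

(* (v, v') is the function v_beta(x, l) together with its x-derivative, for every complex
   l; the prescribed data at S determine it uniquely on [-S,0) and (0,S]. *)
definition is_v_beta ::
  "real \<Rightarrow> (real \<Rightarrow> real) \<Rightarrow> real^2^2 \<Rightarrow> real \<Rightarrow>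
     (real \<Rightarrow> complex \<Rightarrow> complex) \<Rightarrow> (real \<Rightarrow> complex \<Rightarrow> complex) \<Rightarrow> bool" where
  "is_v_beta S q M \<beta> v v' \<longleftrightarrow>
     (\<forall>l. transfer_solution S q M l (\<lambda>x. v x l) (\<lambda>x. v' x l) \<and>
          v S l = complex_of_real (sin \<beta>) \<and> v' S l = complex_of_real (cos \<beta>))"

definition char_det ::
  "real \<Rightarrow> real \<Rightarrow> (real \<Rightarrow> complex \<Rightarrow> complex) \<Rightarrow> (real \<Rightarrow> complex \<Rightarrow> complex) \<Rightarrow> complex \<Rightarrow> complex" where
  "char_det S \<alpha> v v' l =
     v' (-S) l * complex_of_real (sin \<alpha>) - v (-S) l * complex_of_real (cos \<alpha>)"

definition titchmarsh_weyl_m ::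
  "real \<Rightarrow> real \<Rightarrow> (real \<Rightarrow> complex \<Rightarrow> complex) \<Rightarrow> (real \<Rightarrow> complex \<Rightarrow> complex) \<Rightarrow> complex \<Rightarrow> complex" where
  "titchmarsh_weyl_m S \<alpha> v v' l =
     (v (-S) l * complex_of_real (sin \<alpha>) + v' (-S) l * complex_of_real (cos \<alpha>)) / char_det S \<alpha> v v' l"

end

theory Submission
  imports Defs "HOL-Real_Asymp.Real_Asymp"
begin

text \<open>
  For \<open>l = -k\<^sup>2\<close> the combinations \<open>a = v' - k v\<close> and \<open>b = v' + k v\<close> satisfy \<open>a' = -k a + q v\<close> and
  \<open>b' = k b + q v\<close> with \<open>v = (b - a) / (2 k)\<close>: read from right to left, \<open>a\<close> grows and \<open>b\<close> decays
  exponentially, up to a perturbation of relative size \<open>O(1/k)\<close>. Hence a bound \<open>|b| \<le> 2 |a|\<close> at the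
  right end of an interval improves to \<open>|b| = O(1/k) |a|\<close> at its left end. The initial data at
  \<open>S\<close> satisfy the weak bound, and the transfer condition turns the strong bound at \<open>0+\<close> back into the
  weak one at \<open>0-\<close>, for every \<open>M\<close> of determinant 1. So
  \<open>b / a = O(1/k)\<close> at \<open>-S\<close>, and \<open>v' / v = -k (1 + O(1/k))\<close> there.
\<close>

section \<open>Absolute continuity and its closure properties\<close>

lemma absolutely_continuous_on_subset:
  assumes "absolutely_continuous_on I f" "J \<subseteq> I"
  shows "absolutely_continuous_on J f"
  using assms unfolding absolutely_continuous_on_def by (meson order_trans)

lemma division_of_real_member:
  fixes T :: "real set"
  assumes "D division_of T" "K \<in> D"
  shows "Inf K \<in> T" "Sup K \<in> T" "Inf K \<le> Sup K" "K = {Inf K..Sup K}"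
proof -
  obtain u v where K: "K = {u..v}"
    using division_ofD(4)[OF assms] by auto
  moreover have "K \<noteq> {}" "K \<subseteq> T"
    using assms by auto
  ultimately show "Inf K \<in> T" "Sup K \<in> T" "Inf K \<le> Sup K" "K = {Inf K..Sup K}"
    by auto
qed

text \<open>A common source of sums, products and Lipschitz functions: summed over a family of
  intervals, the increments of \<open>h\<close> are controlled by those of \<open>f\<close> and
  \<open>g\<close> and by the total length.\<close>

lemma absolutely_continuous_on_dominated:
  fixes h :: "real \<Rightarrow> 'c::real_normed_vector"
  assumes f: "absolutely_continuous_on I f" and g: "absolutely_continuous_on I g"
    and h: "\<And>s t. s \<in> I \<Longrightarrow> t \<in> I \<Longrightarrow>
      norm (h s - h t) \<le> C * (norm (f s - f t) + norm (g s - g t) + \<bar>s - t\<bar>)"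
  shows "absolutely_continuous_on I h"
  unfolding absolutely_continuous_on_def
proof (intro allI impI)
  fix \<epsilon> :: real assume "\<epsilon> > 0"
  \<comment> \<open>Three sums are to be kept below \<open>e\<close>: the increments of
    \<open>f\<close>, those of \<open>g\<close>, and the lengths. The factor
    \<open>\<bar>C\<bar> + 1\<close> is positive whatever the sign of \<open>C\<close>, which keeps
    the final inequality strict.\<close>
  define e where "e = \<epsilon> / (3 * (\<bar>C\<bar> + 1))"
  have e: "e > 0"
    using \<open>\<epsilon> > 0\<close> by (auto simp: e_def)
  have e3: "(\<bar>C\<bar> + 1) * e = \<epsilon> / 3"
    using abs_ge_zero[of C] by (simp add: e_def divide_simps)
  obtain d1 where d1: "d1 > 0"
    "\<And>D T. D division_of T \<Longrightarrow> T \<subseteq> I \<Longrightarrow> (\<Sum>K\<in>D. Sup K - Inf K) < d1 \<Longrightarrow>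
       (\<Sum>K\<in>D. norm (f (Sup K) - f (Inf K))) < e"
    using f e unfolding absolutely_continuous_on_def by meson
  obtain d2 where d2: "d2 > 0"
    "\<And>D T. D division_of T \<Longrightarrow> T \<subseteq> I \<Longrightarrow> (\<Sum>K\<in>D. Sup K - Inf K) < d2 \<Longrightarrow>
       (\<Sum>K\<in>D. norm (g (Sup K) - g (Inf K))) < e"
    using g e unfolding absolutely_continuous_on_def by meson
  show "\<exists>\<delta>>0. \<forall>D T. D division_of T \<and> T \<subseteq> I \<and> (\<Sum>K\<in>D. Sup K - Inf K) < \<delta> \<longrightarrow>
        (\<Sum>K\<in>D. norm (h (Sup K) - h (Inf K))) < \<epsilon>"
  proof (intro exI[of _ "min e (min d1 d2)"] conjI allI impI)
    show "0 < min e (min d1 d2)"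
      using e d1 d2 by auto
    fix D T assume D: "D division_of T \<and> T \<subseteq> I \<and> (\<Sum>K\<in>D. Sup K - Inf K) < min e (min d1 d2)"
    let ?F = "\<lambda>K. norm (f (Sup K) - f (Inf K)) + norm (g (Sup K) - g (Inf K)) + (Sup K - Inf K)"
    have "norm (h (Sup K) - h (Inf K)) \<le> (\<bar>C\<bar> + 1) * ?F K" if "K \<in> D" for K
    proof -
      have K: "Inf K \<in> I" "Sup K \<in> I" "Inf K \<le> Sup K"
        using division_of_real_member[OF _ that] D by auto
      have "norm (h (Sup K) - h (Inf K)) \<le> C * ?F K"
        using h[of "Sup K" "Inf K"] K by auto
      also have "\<dots> \<le> (\<bar>C\<bar> + 1) * ?F K"
        using K by (intro mult_right_mono) auto
      finally show ?thesis .
    qed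
    then have "(\<Sum>K\<in>D. norm (h (Sup K) - h (Inf K))) \<le> (\<Sum>K\<in>D. (\<bar>C\<bar> + 1) * ?F K)"
      by (rule sum_mono)
    also have "\<dots> = (\<bar>C\<bar> + 1) * (\<Sum>K\<in>D. ?F K)"
      by (simp add: sum_distrib_left)
    also have "\<dots> < (\<bar>C\<bar> + 1) * (e + e + e)"
      using d1(2)[of D T] d2(2)[of D T] D
      by (intro mult_strict_left_mono) (auto simp: sum.distrib)
    also have "\<dots> = \<epsilon>"
      using e3 by (simp add: distrib_left)
    finally show "(\<Sum>K\<in>D. norm (h (Sup K) - h (Inf K))) < \<epsilon>" .
  qed
qed

text \<open>The interval between two nearby points is by itself an admissible family.\<close>

lemma absolutely_continuous_on_imp_continuous_on:
  assumes f: "absolutely_continuous_on {a..b} f"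
  shows "continuous_on {a..b} f"
  unfolding continuous_on_iff
proof (intro ballI allI impI)
  fix x \<epsilon> :: real assume x: "x \<in> {a..b}" and "\<epsilon> > 0"
  then obtain d where d: "d > 0"
    "\<And>D T. D division_of T \<Longrightarrow> T \<subseteq> {a..b} \<Longrightarrow> (\<Sum>K\<in>D. Sup K - Inf K) < d \<Longrightarrow>
       (\<Sum>K\<in>D. norm (f (Sup K) - f (Inf K))) < \<epsilon>"
    using f unfolding absolutely_continuous_on_def by meson
  have *: "dist (f t) (f s) < \<epsilon>" if "s \<in> {a..b}" "t \<in> {a..b}" "s \<le> t" "t - s < d" for s t
  proof -
    have "{{s..t}} division_of {s..t}"
      using division_of_self[of s t] that by (auto simp: box_real)
    from d(2)[OF this] that show ?thesis
      by (auto simp: dist_norm)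
  qed
  show "\<exists>d>0. \<forall>x'\<in>{a..b}. dist x' x < d \<longrightarrow> dist (f x') (f x) < \<epsilon>"
  proof (intro exI[of _ d] conjI ballI impI)
    fix x' assume "x' \<in> {a..b}" "dist x' x < d"
    then show "dist (f x') (f x) < \<epsilon>"
      using *[of x x'] *[of x' x] x by (cases "x \<le> x'") (auto simp: dist_real_def dist_commute)
  qed (use d in auto)
qed

text \<open>With two zero functions as dominating functions, only the length term of the domination
  criterion remains.\<close>

lemma absolutely_continuous_on_lipschitz:
  assumes "L-lipschitz_on I f"
  shows "absolutely_continuous_on I f"
proof (rule absolutely_continuous_on_dominated)
  show "absolutely_continuous_on I (\<lambda>_. 0::real)" "absolutely_continuous_on I (\<lambda>_. 0::real)"
    by (auto simp: absolutely_continuous_on_def intro: exI[of _ 1])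
  show "norm (f s - f t) \<le> L * (norm (0 - 0::real) + norm (0 - 0::real) + \<bar>s - t\<bar>)"
    if "s \<in> I" "t \<in> I" for s t
    using lipschitz_onD[OF assms that] by (simp add: dist_norm)
qed

lemma absolutely_continuous_on_add:
  assumes "absolutely_continuous_on I f" "absolutely_continuous_on I g"
  shows "absolutely_continuous_on I (\<lambda>t. f t + g t)"
proof (rule absolutely_continuous_on_dominated[OF assms])
  show "norm (f s + g s - (f t + g t)) \<le> 1 * (norm (f s - f t) + norm (g s - g t) + \<bar>s - t\<bar>)" for s t
    using norm_diff_triangle_ineq[of "f s" "g s" "f t" "g t"] by auto
qed

text \<open>On a compact interval both factors are bounded, by \<open>F\<close> and
  \<open>G\<close>, so the product increment is dominated with the constant
  \<open>F + G\<close>.\<close>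

lemma absolutely_continuous_on_scaleR:
  assumes f: "absolutely_continuous_on {a..b} f" and g: "absolutely_continuous_on {a..b} g"
  shows "absolutely_continuous_on {a..b} (\<lambda>t. f t *\<^sub>R g t)"
proof -
  have "bounded (f ` {a..b})" "bounded (g ` {a..b})"
    by (auto intro!: compact_imp_bounded compact_continuous_image
        absolutely_continuous_on_imp_continuous_on f g)
  then obtain F G where F: "\<And>t. t \<in> {a..b} \<Longrightarrow> \<bar>f t\<bar> \<le> F" "F > 0"
    and G: "\<And>t. t \<in> {a..b} \<Longrightarrow> norm (g t) \<le> G" "G > 0"
    by (metis bounded_pos imageI real_norm_def)
  show ?thesis
  proof (rule absolutely_continuous_on_dominated[OF f g])
    fix s t assume st: "s \<in> {a..b}" "t \<in> {a..b}"
    have "f s *\<^sub>R g s - f t *\<^sub>R g t = (f s - f t) *\<^sub>R g s + f t *\<^sub>R (g s - g t)"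
      by (simp add: algebra_simps)
    also have "norm \<dots> \<le> \<bar>f s - f t\<bar> * norm (g s) + \<bar>f t\<bar> * norm (g s - g t)"
      using norm_triangle_ineq[of "(f s - f t) *\<^sub>R g s" "f t *\<^sub>R (g s - g t)"] by simp
    also have "\<dots> \<le> \<bar>f s - f t\<bar> * (F + G) + (F + G) * norm (g s - g t)"
      using F(2) G(2) F(1)[OF st(2)] G(1)[OF st(1)]
      by (intro add_mono mult_left_mono mult_right_mono) auto
    also have "\<dots> \<le> (F + G) * (norm (f s - f t) + norm (g s - g t) + \<bar>s - t\<bar>)"
      using F(2) G(2) by (auto simp: algebra_simps)
    finally show "norm (f s *\<^sub>R g s - f t *\<^sub>R g t)
      \<le> (F + G) * (norm (f s - f t) + norm (g s - g t) + \<bar>s - t\<bar>)" .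
  qed
qed

section \<open>Integrating a derivative that is known only off a null set\<close>

lemma fundamental_theorem_of_calculus_absolutely_continuous:
  fixes f f' :: "real \<Rightarrow> 'a::banach"
  assumes "a \<le> b" and ac: "absolutely_continuous_on {a..b} f" and E: "negligible E"
    and der: "\<And>x. x \<in> {a..b} - E \<Longrightarrow> (f has_vector_derivative f' x) (at x within {a..b})"
  shows "(f' has_integral (f b - f a)) {a..b}"
proof -
  \<comment> \<open>With the integrand set to 0 on \<open>E\<close>, the intervals tagged in \<open>E\<close> lie in an open set of small measure,
    so absolute continuity bounds the increments of \<open>f\<close> over them.\<close>
  define g where "g x = (if x \<in> E then 0 else f' x)" for x
  have "(g has_integral (f b - f a)) {a..b}"
    unfolding has_integral_real
  proof (intro allI impI)
    fix \<epsilon> :: real assume \<epsilon>: "\<epsilon> > 0"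
    obtain \<delta> where \<delta>: "\<delta> > 0"
      "\<And>D T. D division_of T \<Longrightarrow> T \<subseteq> {a..b} \<Longrightarrow> (\<Sum>K\<in>D. Sup K - Inf K) < \<delta> \<Longrightarrow>
         (\<Sum>K\<in>D. norm (f (Sup K) - f (Inf K))) < \<epsilon> / 2"
      using ac \<epsilon> unfolding absolutely_continuous_on_def by (metis half_gt_zero)
    obtain U where U: "open U" "E \<subseteq> U" "U \<in> lmeasurable" "measure lebesgue U < \<delta>"
    proof -
      have N: "E \<in> null_sets lebesgue"
        using E by (simp add: negligible_iff_null_sets)
      obtain U where U: "open U" "E \<subseteq> U" "U - E \<in> lmeasurable" "emeasure lebesgue (U - E) < ennreal \<delta>"
        using sets_lebesgue_outer_open[of E \<delta>] N \<delta>(1) by auto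
      have "U = (U - E) \<union> E"
        using U(2) by auto
      moreover have "E \<in> lmeasurable"
        using E by (simp add: negligible_imp_measurable)
      ultimately have "U \<in> lmeasurable"
        using U(3) by (metis fmeasurable.Un)
      moreover have "measure lebesgue U = measure lebesgue (U - E)"
        using N U(1) by (simp add: measure_Diff_null_set)
      moreover have "measure lebesgue (U - E) < \<delta>"
        using U(3,4) \<delta>(1) by (simp add: emeasure_eq_measure2 ennreal_less_iff)
      ultimately show ?thesis
        using that U by auto
    qed
    \<comment> \<open>The intervals tagged off \<open>E\<close> contribute at most
      \<open>e * (b - a)\<close>, hence at most a quarter of \<epsilon>; the summand 1 covers
      \<open>a = b\<close>.\<close>
    define e where "e = \<epsilon> / (4 * (b - a + 1))"
    have e: "e > 0"
      using \<epsilon> \<open>a \<le> b\<close> by (simp add: e_def)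
    \<comment> \<open>The membership condition stands inside the quantifier so that the chosen
      radius is positive at every real \<open>x\<close>, as a gauge demands.\<close>
    have "\<forall>x. \<exists>d>0. x \<in> {a..b} - E \<longrightarrow>
         (\<forall>y\<in>{a..b}. norm (y-x) < d \<longrightarrow> norm (f y - f x - (y-x) *\<^sub>R f' x) \<le> e * norm (y-x))"
      using der[unfolded has_vector_derivative_def has_derivative_within_alt] e
      by (metis zero_less_one)
    then obtain d where d: "\<And>x. 0 < d x"
      "\<And>x y. \<lbrakk>x \<in> {a..b} - E; y \<in> {a..b}; norm (y-x) < d x\<rbrakk>
              \<Longrightarrow> norm (f y - f x - (y-x) *\<^sub>R f' x) \<le> e * norm (y-x)"
      by metis
    define \<gamma> where "\<gamma> x = (if x \<in> E then U else ball x (d x))" for x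
    show "\<exists>\<gamma>. gauge \<gamma> \<and> (\<forall>p. p tagged_division_of {a..b} \<and> \<gamma> fine p \<longrightarrow>
        norm ((\<Sum>(x, k)\<in>p. measure lborel k *\<^sub>R g x) - (f b - f a)) < \<epsilon>)"
    proof (intro exI[of _ \<gamma>] conjI allI impI)
      show "gauge \<gamma>"
        using U d(1) by (auto simp: gauge_def \<gamma>_def)
      fix p assume "p tagged_division_of {a..b} \<and> \<gamma> fine p"
      then have p: "p tagged_division_of {a..b}" and fine: "\<gamma> fine p"
        by auto
      note pD = tagged_division_ofD[OF p]
      have memb: "\<exists>u v. K = {u..v} \<and> u \<le> v \<and> u \<in> {a..b} \<and> v \<in> {a..b} \<and> x \<in> {u..v} \<and> K \<subseteq> \<gamma> x"
        if xK: "(x, K) \<in> p" for x K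
      proof -
        obtain u v where "K = cbox u v"
          using pD(4)[OF xK] by auto
        with pD(2,3)[OF xK] fineD[OF fine xK] show ?thesis
          by (intro exI[of _ u] exI[of _ v]) auto
      qed
      define p1 where "p1 = {(x, K) \<in> p. x \<in> E}"
      define p2 where "p2 = {(x, K) \<in> p. x \<notin> E}"
      have p12: "p = p1 \<union> p2" "p1 \<inter> p2 = {}" "finite p1" "finite p2"
        using pD(1) by (auto simp: p1_def p2_def intro: rev_finite_subset)
      \<comment> \<open>The increments of \<open>f\<close> telescope over a tagged division, so the
        error of the Riemann sum is the sum of these local errors.\<close>
      define \<Phi> where "\<Phi> = (\<lambda>(x::real, K). measure lborel K *\<^sub>R g x - (f (Sup K) - f (Inf K)))"
      have "(\<Sum>(x, k)\<in>p. measure lborel k *\<^sub>R g x) - (f b - f a) = sum \<Phi> p"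
        using additive_tagged_division_1[OF \<open>a \<le> b\<close> p, of f]
        by (simp add: \<Phi>_def sum_subtractf split_def)
      also have "\<dots> = sum \<Phi> p1 + sum \<Phi> p2"
        using p12 by (simp add: sum.union_disjoint)
      finally have split: "(\<Sum>(x, k)\<in>p. measure lborel k *\<^sub>R g x) - (f b - f a) = sum \<Phi> p1 + sum \<Phi> p2" .
      have "norm (sum \<Phi> p2) \<le> (\<Sum>(x,K)\<in>p2. e * (Sup K - Inf K))"
      proof (rule sum_norm_le, safe)
        fix x K assume xK: "(x, K) \<in> p2"
        then have "(x, K) \<in> p" "x \<notin> E"
          by (auto simp: p2_def)
        then obtain u v where K: "K = {u..v}" "u \<le> v" "u \<in> {a..b}" "v \<in> {a..b}" "x \<in> {u..v}" "K \<subseteq> ball x (d x)"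
          using memb[of x K] by (auto simp: \<gamma>_def)
        have x: "x \<in> {a..b} - E"
          using K \<open>x \<notin> E\<close> by auto
        have "u \<in> K" "v \<in> K"
          using K(1,2) by auto
        then have "u \<in> ball x (d x)" "v \<in> ball x (d x)"
          using K(6) by auto
        then have "norm (u-x) < d x" "norm (v-x) < d x"
          by (auto simp: dist_real_def)
        then have "norm (f u - f x - (u-x) *\<^sub>R f' x) \<le> e * norm (u-x)"
          "norm (f v - f x - (v-x) *\<^sub>R f' x) \<le> e * norm (v-x)"
          using d(2)[OF x] K(3,4) by blast+
        \<comment> \<open>The error is split at the tag \<open>x\<close>, where the derivative
          estimate is available. As \<open>u \<le> x \<le> v\<close>, the two distances to the tag
          add up to the length of \<open>K\<close>.\<close>
        moreover have \<Phi>: "\<Phi> (x, K) = (f u - f x - (u-x) *\<^sub>R f' x) - (f v - f x - (v-x) *\<^sub>R f' x)"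
          using K \<open>x \<notin> E\<close> by (simp add: \<Phi>_def g_def algebra_simps)
        ultimately have "norm (\<Phi> (x, K)) \<le> e * norm (u-x) + e * norm (v-x)"
          unfolding \<Phi> using norm_triangle_ineq4[of "f u - f x - (u-x) *\<^sub>R f' x" "f v - f x - (v-x) *\<^sub>R f' x"] by linarith
        also have "\<dots> = e * (Sup K - Inf K)"
          using K by (simp add: algebra_simps)
        finally show "norm (\<Phi> (x, K)) \<le> e * (Sup K - Inf K)" .
      qed
      also have "\<dots> \<le> (\<Sum>(x,K)\<in>p. e * (Sup K - Inf K))"
      proof (rule sum_mono2)
        show "finite p" "p2 \<subseteq> p"
          using pD(1) p12(1) by auto
        show "0 \<le> (case z of (x, K) \<Rightarrow> e * (Sup K - Inf K))" if "z \<in> p - p2" for z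
          using memb[of "fst z" "snd z"] that e by (cases z) auto
      qed
      also have "\<dots> = e * (b - a)"
        using additive_tagged_division_1[OF \<open>a \<le> b\<close> p, of "\<lambda>x. x"]
        by (simp add: sum_distrib_left[symmetric] split_def)
      also have "\<dots> \<le> \<epsilon> / 4"
        using \<epsilon> \<open>a \<le> b\<close> by (simp add: e_def field_simps)
      finally have n2: "norm (sum \<Phi> p2) \<le> \<epsilon> / 4" .
      have tp1: "p1 tagged_partial_division_of {a..b}"
        using p p12(1) unfolding tagged_division_of_def
        by (metis Un_upper1 tagged_partial_division_subset)
      define D where "D = snd ` p1"
      have D: "D division_of \<Union>D"
        unfolding D_def by (rule partial_division_of_tagged_division[OF tp1])
      have DU: "\<Union>D \<subseteq> U" "\<Union>D \<subseteq> {a..b}"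
      proof -
        have "K \<subseteq> U \<and> K \<subseteq> {a..b}" if "(x, K) \<in> p1" for x K
          using that memb[of x K] pD(3)[of x K] by (auto simp: p1_def \<gamma>_def)
        then show "\<Union>D \<subseteq> U" "\<Union>D \<subseteq> {a..b}"
          unfolding D_def by fastforce+
      qed
      \<comment> \<open>The intervals do not overlap, so their total length is the measure of their
        union, which lies in \<open>U\<close>.\<close>
      have "(\<Sum>K\<in>D. Sup K - Inf K) = (\<Sum>K\<in>D. measure lebesgue K)"
      proof (rule sum.cong)
        show "Sup K - Inf K = measure lebesgue K" if "K \<in> D" for K
        proof -
          have "measure lebesgue {Inf K..Sup K} = Sup K - Inf K"
            using division_of_real_member(3)[OF D that] by simp
          then show ?thesis
            by (simp flip: division_of_real_member(4)[OF D that])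
        qed
      qed simp
      also have "\<dots> = measure lebesgue (\<Union>D)"
        by (rule content_division[OF D])
      also have "\<dots> \<le> measure lebesgue U"
        using DU(1) U(3) by (rule measure_mono_fmeasurable[OF _ fmeasurableD[OF lmeasurable_division[OF D]]])
      also have "\<dots> < \<delta>"
        by (rule U)
      finally have small: "(\<Sum>K\<in>D. norm (f (Sup K) - f (Inf K))) < \<epsilon> / 2"
        by (intro \<delta>(2)[OF D DU(2)])
      \<comment> \<open>Passing from tagged intervals to the set \<open>D\<close> may merge pairs
        sharing a degenerate interval, so the summand must vanish whenever the interior is empty.
        The default 0 settles the empty interval, whose \<open>Inf\<close> and \<open>Sup\<close>
        carry no information.\<close>
      define \<nu> where "\<nu> K = (if K = {} then 0 else norm (f (Sup K) - f (Inf K)))" for K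
      have "norm (sum \<Phi> p1) \<le> (\<Sum>(x,K)\<in>p1. \<nu> K)"
      proof (rule sum_norm_le, safe)
        show "norm (\<Phi> (x, K)) \<le> \<nu> K" if "(x, K) \<in> p1" for x K
          using that memb[of x K] by (auto simp: \<Phi>_def \<nu>_def p1_def g_def norm_minus_commute)
      qed
      also have "\<dots> = sum \<nu> (snd ` p1)"
      proof (rule sum.over_tagged_division_lemma[OF tagged_partial_division_of_Union_self[OF tp1]])
        show "\<nu> (cbox u v) = 0" if "box u v = {}" for u v
          using that by (cases "u = v") (auto simp: \<nu>_def)
      qed
      also have "\<dots> = (\<Sum>K\<in>D. norm (f (Sup K) - f (Inf K)))"
        using division_ofD(3)[OF D] by (auto simp: D_def \<nu>_def intro!: sum.cong)
      finally have "norm (sum \<Phi> p1) < \<epsilon> / 2"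
        using small by linarith
      with n2 \<epsilon> show "norm ((\<Sum>(x, k)\<in>p. measure lborel k *\<^sub>R g x) - (f b - f a)) < \<epsilon>"
        unfolding split using norm_triangle_ineq[of "sum \<Phi> p1" "sum \<Phi> p2"] by linarith
    qed
  qed
  then show ?thesis
    by (rule has_integral_spike[OF E, rotated]) (auto simp: g_def)
qed

section \<open>Growing and decaying modes on one interval\<close>

text \<open>A continuous derivative is bounded on a compact interval, which makes \<open>f\<close>
  Lipschitz. This serves the exponential weights below.\<close>

lemma absolutely_continuous_on_C1:
  fixes f f' :: "real \<Rightarrow> real"
  assumes der: "\<And>x. x \<in> {a..b} \<Longrightarrow> (f has_real_derivative f' x) (at x within {a..b})"
    and "continuous_on {a..b} f'"
  shows "absolutely_continuous_on {a..b} f"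
proof -
  have "bounded (f' ` {a..b})"
    by (intro compact_imp_bounded compact_continuous_image assms compact_Icc)
  then obtain B where B: "\<And>x. x \<in> {a..b} \<Longrightarrow> norm (f' x) \<le> B" "B > 0"
    by (metis bounded_pos imageI)
  have "B-lipschitz_on {a..b} f"
    using field_differentiable_bound[OF _ der B(1)] B(2)
    by (intro lipschitz_onI) (auto simp: dist_norm)
  then show ?thesis
    by (rule absolutely_continuous_on_lipschitz)
qed

text \<open>Variation of constants: the equation gives \<open>w' = \<sigma> w + q y\<close> almost
  everywhere, and the integrating factor \<open>exp (- \<sigma> * t)\<close> removes the first term.
  Both modes are covered, with \<sigma> equal to \<open>k\<close> or \<open>- k\<close>.\<close>

lemma sl_mode_has_integral:
  fixes \<sigma> :: real
  assumes sol: "sl_solution_on I q (complex_of_real (- (\<sigma>\<^sup>2))) y y'"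
    and sub: "{x..x0} \<subseteq> I" and "x \<le> x0"
  defines "w \<equiv> \<lambda>t. y' t + \<sigma> *\<^sub>R y t"
  shows "((\<lambda>t. (exp (- \<sigma> * t) * q t) *\<^sub>R y t) has_integral
           exp (- \<sigma> * x0) *\<^sub>R w x0 - exp (- \<sigma> * x) *\<^sub>R w x) {x..x0}"
proof -
  have ac: "absolutely_continuous_on {x..x0} y" "absolutely_continuous_on {x..x0} y'"
    and der: "\<And>t. t \<in> I \<Longrightarrow> (y has_vector_derivative y' t) (at t within I)"
    and ae: "AE t in lebesgue. t \<in> I \<longrightarrow>
        (\<exists>y2. (y' has_vector_derivative y2) (at t within I) \<and>
              - y2 + complex_of_real (q t) * y t = complex_of_real (- (\<sigma>\<^sup>2)) * y t)"
      (is "AE t in lebesgue. t \<in> I \<longrightarrow> ?P t")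
    using sol sub absolutely_continuous_on_subset unfolding sl_solution_on_def by blast+
  obtain N where N: "N \<in> null_sets lebesgue" and "{t \<in> space lebesgue. \<not> (t \<in> I \<longrightarrow> ?P t)} \<subseteq> N"
    using ae unfolding eventually_ae_filter by blast
  then have N': "?P t" if "t \<in> I" "t \<notin> N" for t
    using that unfolding space_completion space_lborel space_borel by blast
  have ac_exp: "absolutely_continuous_on {x..x0} (\<lambda>t. exp (- \<sigma> * t))"
    by (rule absolutely_continuous_on_C1[where f' = "\<lambda>t. - \<sigma> * exp (- \<sigma> * t)"])
       (auto intro!: derivative_eq_intros continuous_intros)
  have ac_const: "absolutely_continuous_on {x..x0} (\<lambda>_. \<sigma>)"
    by (rule absolutely_continuous_on_lipschitz[of 0]) (auto intro: lipschitz_intros)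
  show ?thesis
  proof (rule fundamental_theorem_of_calculus_absolutely_continuous[OF \<open>x \<le> x0\<close>])
    show "absolutely_continuous_on {x..x0} (\<lambda>t. exp (- \<sigma> * t) *\<^sub>R w t)"
      unfolding w_def
      by (intro absolutely_continuous_on_scaleR absolutely_continuous_on_add ac ac_exp ac_const)
    show "negligible N"
      using N by (simp add: negligible_iff_null_sets)
    fix t assume t: "t \<in> {x..x0} - N"
    then obtain y2 where "(y' has_vector_derivative y2) (at t within I)"
      and eq: "- y2 + complex_of_real (q t) * y t = complex_of_real (- (\<sigma>\<^sup>2)) * y t"
      using N'[of t] sub by blast
    then have d2: "(y' has_vector_derivative y2) (at t within {x..x0})"
      using has_vector_derivative_within_subset sub by blast
    have d1: "(y has_vector_derivative y' t) (at t within {x..x0})"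
      using has_vector_derivative_within_subset[OF der] t sub by blast
    have d0: "((\<lambda>t. exp (- \<sigma> * t)) has_real_derivative - \<sigma> * exp (- \<sigma> * t)) (at t within {x..x0})"
      by (auto intro!: derivative_eq_intros)
    have y2: "y2 = q t *\<^sub>R y t + (\<sigma> * \<sigma>) *\<^sub>R y t"
      using eq by (simp add: scaleR_conv_of_real power2_eq_square algebra_simps)
    have "((\<lambda>t. exp (- \<sigma> * t) *\<^sub>R w t) has_vector_derivative
        exp (- \<sigma> * t) *\<^sub>R (y2 + \<sigma> *\<^sub>R y' t) + (- \<sigma> * exp (- \<sigma> * t)) *\<^sub>R w t) (at t within {x..x0})"
      unfolding w_def
      by (intro has_vector_derivative_scaleR d0 has_vector_derivative_add d2
          bounded_linear.has_vector_derivative[OF bounded_linear_scaleR_right] d1)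
    also have "exp (- \<sigma> * t) *\<^sub>R (y2 + \<sigma> *\<^sub>R y' t) + (- \<sigma> * exp (- \<sigma> * t)) *\<^sub>R w t
        = (exp (- \<sigma> * t) * q t) *\<^sub>R y t"
      by (simp add: y2 w_def algebra_simps)
    finally show "((\<lambda>t. exp (- \<sigma> * t) *\<^sub>R w t) has_vector_derivative
        (exp (- \<sigma> * t) * q t) *\<^sub>R y t) (at t within {x..x0})" .
  qed
qed

text \<open>Square integrability of \<open>q\<close> on a bounded interval thus yields the
  integrable majorant \<open>1 + (q t)\<^sup>2\<close> of its absolute value.\<close>

lemma abs_le_one_plus_square: "\<bar>r\<bar> \<le> 1 + r\<^sup>2" for r :: real
proof -
  have "0 \<le> (\<bar>r\<bar> - 1)\<^sup>2 + \<bar>r\<bar>"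
    by simp
  then show ?thesis
    by (simp add: power2_eq_square algebra_simps)
qed

text \<open>Compares \<open>w\<close> with the mode of the equation without potential. The error is
  an integral of \<open>exp (\<sigma> * (x - t)) * q t\<close> against \<open>y t\<close>; since
  \<open>\<bar>\<sigma>\<bar> \<le> k\<close>, the kernel grows no faster than the bound on
  \<open>y\<close> allows, for either mode.\<close>

lemma sl_mode_deviation:
  fixes \<sigma> k :: real
  assumes sol: "sl_solution_on I q (complex_of_real (- (\<sigma>\<^sup>2))) y y'"
    and sub: "{x..x0} \<subseteq> I" and "x \<le> x0" and "\<bar>\<sigma>\<bar> \<le> k" and "0 \<le> N"
    and q: "(\<lambda>t. 1 + (q t)\<^sup>2) integrable_on {x..x0}"
      "integral {x..x0} (\<lambda>t. 1 + (q t)\<^sup>2) \<le> Q"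
    and y: "\<And>t. t \<in> {x..x0} \<Longrightarrow> norm (y t) \<le> N * exp (k * (x0 - t))"
  defines "w \<equiv> \<lambda>t. y' t + \<sigma> *\<^sub>R y t"
  shows "norm (w x - exp (\<sigma> * (x - x0)) *\<^sub>R w x0) \<le> exp (k * (x0 - x)) * (N * Q)"
proof -
  let ?c = "exp (- \<sigma> * x) * exp (k * (x0 - x)) * N"
  have int: "((\<lambda>t. (exp (- \<sigma> * t) * q t) *\<^sub>R y t) has_integral
      exp (- \<sigma> * x0) *\<^sub>R w x0 - exp (- \<sigma> * x) *\<^sub>R w x) {x..x0}"
    unfolding w_def by (rule sl_mode_has_integral[OF sol sub \<open>x \<le> x0\<close>])
  have "norm (exp (- \<sigma> * x0) *\<^sub>R w x0 - exp (- \<sigma> * x) *\<^sub>R w x)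
      = norm (integral {x..x0} (\<lambda>t. (exp (- \<sigma> * t) * q t) *\<^sub>R y t))"
    using integral_unique[OF int] by simp
  also have "\<dots> \<le> integral {x..x0} (\<lambda>t. ?c * (1 + (q t)\<^sup>2))"
  proof (rule integral_norm_bound_integral)
    fix t assume t: "t \<in> {x..x0}"
    \<comment> \<open>This product is the difference of the two exponents compared next.\<close>
    have "0 \<le> (k + \<sigma>) * (t - x)"
      using t \<open>\<bar>\<sigma>\<bar> \<le> k\<close> by (intro mult_nonneg_nonneg) auto
    then have "exp (- \<sigma> * t) * exp (k * (x0 - t)) \<le> exp (- \<sigma> * x) * exp (k * (x0 - x))"
      by (simp add: exp_add[symmetric] algebra_simps)
    then have "(exp (- \<sigma> * t) * exp (k * (x0 - t))) * (N * (1 + (q t)\<^sup>2)) \<le>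
      (exp (- \<sigma> * x) * exp (k * (x0 - x))) * (N * (1 + (q t)\<^sup>2))"
      using \<open>0 \<le> N\<close> by (intro mult_right_mono) auto
    moreover have "norm ((exp (- \<sigma> * t) * q t) *\<^sub>R y t)
      \<le> exp (- \<sigma> * t) * (1 + (q t)\<^sup>2) * (N * exp (k * (x0 - t)))"
      using y[OF t] abs_le_one_plus_square[of "q t"]
      by (simp add: abs_mult) (intro mult_mono; simp)
    ultimately show "norm ((exp (- \<sigma> * t) * q t) *\<^sub>R y t) \<le> ?c * (1 + (q t)\<^sup>2)"
      by (simp add: mult_ac)
  next
    show "(\<lambda>t. ?c * (1 + (q t)\<^sup>2)) integrable_on {x..x0}"
      using q(1) by (rule integrable_on_mult_right)
  qed (use int in blast)
  also have "\<dots> = ?c * integral {x..x0} (\<lambda>t. 1 + (q t)\<^sup>2)"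
    by (rule integral_mult_right)
  also have "\<dots> \<le> ?c * Q"
    using q(2) \<open>0 \<le> N\<close> by (intro mult_left_mono) auto
  finally have *: "norm (exp (- \<sigma> * x0) *\<^sub>R w x0 - exp (- \<sigma> * x) *\<^sub>R w x) \<le> ?c * Q" .
  have "w x - exp (\<sigma> * (x - x0)) *\<^sub>R w x0
      = - (exp (\<sigma> * x) *\<^sub>R (exp (- \<sigma> * x0) *\<^sub>R w x0 - exp (- \<sigma> * x) *\<^sub>R w x))"
    by (simp add: scaleR_diff_right exp_add[symmetric] algebra_simps)
  then have "norm (w x - exp (\<sigma> * (x - x0)) *\<^sub>R w x0)
      = exp (\<sigma> * x) * norm (exp (- \<sigma> * x0) *\<^sub>R w x0 - exp (- \<sigma> * x) *\<^sub>R w x)"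
    by simp
  also have "\<dots> \<le> exp (\<sigma> * x) * (?c * Q)"
    using * by (intro mult_left_mono) auto
  also have "\<dots> = exp (k * (x0 - x)) * (N * Q)"
    by (simp add: exp_minus field_simps)
  finally show ?thesis .
qed

text \<open>Over a distance of at least \<open>d\<close> the free mode \<open>b\<close> becomes
  smaller than the free mode \<open>a\<close> by a factor of order \<open>1 / (k * d)\<close>, and
  the potential adds an error of order \<open>Q / k\<close>. The condition
  \<open>8 * Q \<le> k\<close> lets this error be absorbed.\<close>

lemma sl_mode_dichotomy:
  fixes k :: real
  assumes sol: "sl_solution_on I q (complex_of_real (- (k\<^sup>2))) y y'"
    and sub: "{x..x0} \<subseteq> I" and d: "0 < d" "d \<le> x0 - x" and k: "0 < k" "8 * Q \<le> k"
    and q: "(\<lambda>t. 1 + (q t)\<^sup>2) integrable_on {x..x0}"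
      "integral {x..x0} (\<lambda>t. 1 + (q t)\<^sup>2) \<le> Q"
  defines "a \<equiv> \<lambda>t. y' t - k *\<^sub>R y t" and "b \<equiv> \<lambda>t. y' t + k *\<^sub>R y t"
  assumes ini: "norm (b x0) \<le> 2 * norm (a x0)"
  shows "norm (a x0) / 2 \<le> norm (a x)"
    and "norm (b x) \<le> (2 / d + 8 * Q) / k * norm (a x)"
proof -
  have "x < x0"
    using d by auto
  have ac: "absolutely_continuous_on {x..x0} y" "absolutely_continuous_on {x..x0} y'"
    using sol sub absolutely_continuous_on_subset unfolding sl_solution_on_def by blast+
  note cont = ac[THEN absolutely_continuous_on_imp_continuous_on]
  have Q: "integral {t..x0} (\<lambda>t. 1 + (q t)\<^sup>2) \<le> Q" "(\<lambda>t. 1 + (q t)\<^sup>2) integrable_on {t..x0}"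
    if "t \<in> {x..x0}" for t
  proof -
    show int: "(\<lambda>t. 1 + (q t)\<^sup>2) integrable_on {t..x0}"
      using q(1) that by (auto intro: integrable_on_subinterval)
    have "integral {t..x0} (\<lambda>t. 1 + (q t)\<^sup>2) \<le> integral {x..x0} (\<lambda>t. 1 + (q t)\<^sup>2)"
      using that by (intro integral_subset_le int q(1)) auto
    with q(2) show "integral {t..x0} (\<lambda>t. 1 + (q t)\<^sup>2) \<le> Q"
      by simp
  qed
  have "0 \<le> Q"
    using q by (intro order_trans[OF integral_nonneg q(2)]) auto
  have exp_shift: "exp (- z) * m \<le> n \<longleftrightarrow> m \<le> n * exp z" for z m n :: real
    by (simp add: exp_minus field_simps)
  \<comment> \<open>The maximum \<open>N\<close> of the rescaled modes bounds \<open>y\<close>, and the deviation estimate at the maximum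
    point bounds \<open>N\<close> in terms of itself with a factor \<open>Q / k\<close>.\<close>
  define G where "G t = exp (- (k * (x0 - t))) * max (norm (a t)) (norm (b t))" for t
  have "continuous_on {x..x0} G"
    unfolding G_def a_def b_def by (intro continuous_intros cont)
  then obtain t0 where t0: "t0 \<in> {x..x0}" "\<And>t. t \<in> {x..x0} \<Longrightarrow> G t \<le> G t0"
    using continuous_attains_sup[of "{x..x0}" G] \<open>x < x0\<close> by auto
  define N where "N = G t0"
  have "0 \<le> N"
    by (auto simp: N_def G_def zero_le_mult_iff le_max_iff_disj)
  have ab: "norm (a t) \<le> N * exp (k * (x0 - t))" "norm (b t) \<le> N * exp (k * (x0 - t))"
    if "t \<in> {x..x0}" for t
  proof -
    have "exp (- (k * (x0 - t))) * max (norm (a t)) (norm (b t)) \<le> N"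
      using t0(2)[OF that] by (simp add: N_def G_def)
    then have "max (norm (a t)) (norm (b t)) \<le> N * exp (k * (x0 - t))"
      by (simp only: exp_shift)
    then show "norm (a t) \<le> N * exp (k * (x0 - t))" "norm (b t) \<le> N * exp (k * (x0 - t))"
      by auto
  qed
  have y: "norm (y t) \<le> (N / k) * exp (k * (x0 - t))" if "t \<in> {x..x0}" for t
  proof -
    have "b t - a t = (2 * k) *\<^sub>R y t"
      by (simp add: a_def b_def scaleR_left_distrib[symmetric])
    then have "2 * k * norm (y t) = norm (b t - a t)"
      using k by simp
    also have "\<dots> \<le> 2 * (N * exp (k * (x0 - t)))"
      using norm_triangle_ineq4[of "b t" "a t"] ab[OF that] by linarith
    finally show ?thesis
      using k by (simp add: field_simps)
  qed
  have dev_a: "norm (a t - exp (k * (x0 - t)) *\<^sub>R a x0) \<le> exp (k * (x0 - t)) * (N / k * Q)"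
    and dev_b: "norm (b t - exp (- (k * (x0 - t))) *\<^sub>R b x0) \<le> exp (k * (x0 - t)) * (N / k * Q)"
    if t: "t \<in> {x..x0}" for t
  proof -
    have s: "{t..x0} \<subseteq> I" "t \<le> x0" and N: "0 \<le> N / k"
      using sub t \<open>0 \<le> N\<close> k by auto
    have e: "- k * (t - x0) = k * (x0 - t)" "k * (t - x0) = - (k * (x0 - t))"
      by (simp_all add: algebra_simps)
    show "norm (a t - exp (k * (x0 - t)) *\<^sub>R a x0) \<le> exp (k * (x0 - t)) * (N / k * Q)"
      using sl_mode_deviation[of I q "- k" y y' t x0 k "N / k" Q, unfolded e] sol s N k Q[OF t] y t
      by (simp add: a_def)
    show "norm (b t - exp (- (k * (x0 - t))) *\<^sub>R b x0) \<le> exp (k * (x0 - t)) * (N / k * Q)"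
      using sl_mode_deviation[of I q k y y' t x0 k "N / k" Q, unfolded e] sol s N k Q[OF t] y t
      by (simp add: b_def)
  qed
  have upper_b: "norm (b t) \<le> exp (- (k * (x0 - t))) * (2 * norm (a x0)) + exp (k * (x0 - t)) * (N / k * Q)"
    if "t \<in> {x..x0}" for t
  proof -
    have "norm (b t) \<le> norm (exp (- (k * (x0 - t))) *\<^sub>R b x0) + exp (k * (x0 - t)) * (N / k * Q)"
      using dev_b[OF that] norm_triangle_sub[of "b t" "exp (- (k * (x0 - t))) *\<^sub>R b x0"] by linarith
    also have "norm (exp (- (k * (x0 - t))) *\<^sub>R b x0) \<le> exp (- (k * (x0 - t))) * (2 * norm (a x0))"
      using ini by simp
    finally show ?thesis
      by simp
  qed
  have NQ: "N / k * Q \<le> N / 8"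
    using k \<open>0 \<le> N\<close> mult_left_mono[OF k(2), of N] by (simp add: field_simps)
  have "N \<le> 2 * norm (a x0) + N / k * Q"
  proof -
    \<comment> \<open>At the maximum point the decaying exponential is replaced by the growing one,
      so that both modes obey the same bound; the 2 comes from the initial ratio.\<close>
    have E: "exp (- (k * (x0 - t0))) \<le> exp (k * (x0 - t0))"
      using t0(1) k by simp
    have "norm (a t0) \<le> norm (exp (k * (x0 - t0)) *\<^sub>R a x0) + exp (k * (x0 - t0)) * (N / k * Q)"
      using dev_a[OF t0(1)] norm_triangle_sub[of "a t0" "exp (k * (x0 - t0)) *\<^sub>R a x0"] by linarith
    also have "\<dots> \<le> exp (k * (x0 - t0)) * (2 * norm (a x0) + N / k * Q)"
      by (simp add: distrib_left)
    finally have "norm (a t0) \<le> exp (k * (x0 - t0)) * (2 * norm (a x0) + N / k * Q)" .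
    moreover have "norm (b t0) \<le> exp (k * (x0 - t0)) * (2 * norm (a x0) + N / k * Q)"
      using upper_b[OF t0(1)] mult_right_mono[OF E, of "2 * norm (a x0)"] by (simp add: distrib_left)
    ultimately have "max (norm (a t0)) (norm (b t0)) \<le> (2 * norm (a x0) + N / k * Q) * exp (k * (x0 - t0))"
      by (simp add: mult.commute)
    then show ?thesis
      by (simp only: exp_shift[symmetric] G_def[symmetric] N_def[symmetric])
  qed
  \<comment> \<open>Absorbing \<open>N / 8\<close> on the left leaves a factor 16/7, rounded up to
    4. The perturbation is then at most half of \<open>norm (a x0)\<close>, so at least half of the
    growing mode survives.\<close>
  with NQ have N: "N \<le> 4 * norm (a x0)"
    using \<open>0 \<le> N\<close> by linarith
  have x: "x \<in> {x..x0}"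
    using \<open>x < x0\<close> by simp
  have "exp (k * (x0 - x)) * norm (a x0) \<le> norm (a x) + exp (k * (x0 - x)) * (N / k * Q)"
    using dev_a[OF x] norm_triangle_sub[of "exp (k * (x0 - x)) *\<^sub>R a x0" "a x"]
    by (simp add: norm_minus_commute)
  also have "N / k * Q \<le> norm (a x0) / 2"
    using NQ N by linarith
  finally have low: "exp (k * (x0 - x)) * (norm (a x0) / 2) \<le> norm (a x)"
    by simp
  have "1 * (norm (a x0) / 2) \<le> exp (k * (x0 - x)) * (norm (a x0) / 2)"
    using \<open>x < x0\<close> k by (intro mult_right_mono) auto
  with low show "norm (a x0) / 2 \<le> norm (a x)"
    by linarith
  \<comment> \<open>Equivalent to \<open>2 * k * d \<le> exp (2 * k * (x0 - x))\<close>, which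
    follows from \<open>1 + z \<le> exp z\<close>.\<close>
  have decay: "exp (- (k * (x0 - x))) \<le> exp (k * (x0 - x)) * (1 / (2 * k * d))"
  proof -
    have kd: "0 < 2 * k * d" "2 * k * d \<le> 2 * (k * (x0 - x))"
      using k d by auto
    have "2 * k * d \<le> exp (2 * (k * (x0 - x)))"
      using kd exp_ge_add_one_self[of "2 * (k * (x0 - x))"] by linarith
    also have "\<dots> = exp (k * (x0 - x)) * exp (k * (x0 - x))"
      by (simp add: exp_add[symmetric])
    finally have "1 \<le> exp (k * (x0 - x)) * (1 / (2 * k * d)) * exp (k * (x0 - x))"
      using kd(1) by (simp add: pos_le_divide_eq)
    then show ?thesis
      using exp_shift[of "k * (x0 - x)" 1] by simp
  qed
  have "N / k * Q \<le> 4 * norm (a x0) / k * Q"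
    using N k \<open>0 \<le> Q\<close> by (intro mult_right_mono divide_right_mono) auto
  then have "exp (k * (x0 - x)) * (N / k * Q) \<le> exp (k * (x0 - x)) * (4 * norm (a x0) / k * Q)"
    by (rule mult_left_mono) simp
  moreover have "exp (- (k * (x0 - x))) * (2 * norm (a x0))
      \<le> exp (k * (x0 - x)) * (1 / (2 * k * d)) * (2 * norm (a x0))"
    by (rule mult_right_mono[OF decay]) simp
  ultimately have "norm (b x) \<le> exp (k * (x0 - x)) * (1 / (2 * k * d)) * (2 * norm (a x0))
      + exp (k * (x0 - x)) * (4 * norm (a x0) / k * Q)"
    using upper_b[OF x] by linarith
  \<comment> \<open>Half of \<open>norm (a x0)\<close> is split off to match the lower bound
    \<open>low\<close>; this doubles the constants \<open>1 / d\<close> and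
    \<open>4 * Q\<close>.\<close>
  also have "\<dots> = (2 / d + 8 * Q) / k * (exp (k * (x0 - x)) * (norm (a x0) / 2))"
    using k d by (simp add: field_simps)
  also have "\<dots> \<le> (2 / d + 8 * Q) / k * norm (a x)"
    using low k d \<open>0 \<le> Q\<close> by (intro mult_left_mono) auto
  finally show "norm (b x) \<le> (2 / d + 8 * Q) / k * norm (a x)" .
qed

section \<open>Propagating the mode ratio from S to -S\<close>

text \<open>With \<open>b = O(1/k) a\<close> on the right, the ratio on the left is governed by
  \<open>R / P\<close>. If \<open>m12\<close> is nonzero, both grow like \<open>k * m12 / 2\<close>
  in absolute value and the ratio tends to 1; if \<open>m12 = 0\<close>, the determinant forces a
  limit below 1. The constant 2 leaves room in both cases.\<close>

lemma transfer_keeps_mode_ratio: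
  fixes M :: "real^2^2" and E :: real
  assumes "det M = 1"
  shows "\<forall>\<^sub>F k in at_top. \<forall>ym ym' yp yp' :: complex.
     (vector [yp, yp'] :: complex^2) =
        (\<chi> i j. complex_of_real (M $ i $ j)) *v (vector [ym, ym'] :: complex^2) \<longrightarrow>
     norm (yp' + k *\<^sub>R yp) \<le> E / k * norm (yp' - k *\<^sub>R yp) \<longrightarrow> yp' - k *\<^sub>R yp \<noteq> 0 \<longrightarrow>
     norm (ym' + k *\<^sub>R ym) < 2 * norm (ym' - k *\<^sub>R ym)"
proof -
  define m11 m12 m21 m22 where m: "m11 = M $ 1 $ 1" "m12 = M $ 1 $ 2" "m21 = M $ 2 $ 1" "m22 = M $ 2 $ 2"
  have det: "m11 * m22 - m12 * m21 = 1"
    using assms by (simp add: det_2 m)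
  define P where "P = (\<lambda>k. (m21 / k + m11 + m22 + k * m12) / 2)"
  define R where "R = (\<lambda>k. (m21 / k + m11 - m22 - k * m12) / 2)"
  define U where "U = (\<lambda>k. (- m21 / k + m11 - m22 + k * m12) / 2)"
  define W where "W = (\<lambda>k. (- m21 / k + m11 + m22 - k * m12) / 2)"
  \<comment> \<open>\<open>P\<close>, \<open>U\<close> and \<open>R\<close>, \<open>W\<close> express \<open>ym' - k ym\<close> and \<open>ym' + k ym\<close> through
    \<open>yp' - k yp\<close> and \<open>yp' + k yp\<close>.\<close>
  define F where "F = (\<lambda>k. 2 * \<bar>P k\<bar> - \<bar>R k\<bar> - (2 * \<bar>U k\<bar> + \<bar>W k\<bar>) * (E / k))"
  have "\<forall>\<^sub>F k in at_top. F k > 0"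
  proof (cases "m12 = 0")
    case True
    have "(P \<longlongrightarrow> (m11 + m22) / 2) at_top" "(R \<longlongrightarrow> (m11 - m22) / 2) at_top"
      "(U \<longlongrightarrow> (m11 - m22) / 2) at_top" "(W \<longlongrightarrow> (m11 + m22) / 2) at_top"
      "((\<lambda>k. E / k) \<longlongrightarrow> 0) at_top"
      unfolding P_def R_def U_def W_def True by real_asymp+
    then have lim: "(F \<longlongrightarrow> 2 * \<bar>(m11 + m22) / 2\<bar> - \<bar>(m11 - m22) / 2\<bar>
        - (2 * \<bar>(m11 - m22) / 2\<bar> + \<bar>(m11 + m22) / 2\<bar>) * 0) at_top"
      unfolding F_def by (intro tendsto_intros)
    have "\<bar>m11 - m22\<bar> < \<bar>m11 + m22\<bar>"
    proof -
      \<comment> \<open>The two squares differ by \<open>4 * m11 * m22\<close>, which equals 4 when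
        \<open>m12 = 0\<close>.\<close>
      have "(m11 - m22)\<^sup>2 < (m11 + m22)\<^sup>2"
        using det True by (simp add: power2_eq_square algebra_simps)
      then show ?thesis
        using abs_le_square_iff[of "m11 + m22" "m11 - m22"] by linarith
    qed
    then have "0 < 2 * \<bar>(m11 + m22) / 2\<bar> - \<bar>(m11 - m22) / 2\<bar>
        - (2 * \<bar>(m11 - m22) / 2\<bar> + \<bar>(m11 + m22) / 2\<bar>) * 0"
      by (simp, elim less_le_trans) simp
    then show ?thesis
      by (rule order_tendstoD(1)[OF lim])
  next
    case False
    \<comment> \<open>The coefficients now grow linearly, so limits are taken after division by
      \<open>k\<close>.\<close>
    have "((\<lambda>k. P k / k) \<longlongrightarrow> m12 / 2) at_top" "((\<lambda>k. R k / k) \<longlongrightarrow> - m12 / 2) at_top"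
      "((\<lambda>k. U k / k) \<longlongrightarrow> m12 / 2) at_top" "((\<lambda>k. W k / k) \<longlongrightarrow> - m12 / 2) at_top"
      "((\<lambda>k. E / k) \<longlongrightarrow> 0) at_top"
      unfolding P_def R_def U_def W_def by real_asymp+
    then have "((\<lambda>k. 2 * \<bar>P k / k\<bar> - \<bar>R k / k\<bar> - (2 * \<bar>U k / k\<bar> + \<bar>W k / k\<bar>) * (E / k))
      \<longlongrightarrow> 2 * \<bar>m12 / 2\<bar> - \<bar>- m12 / 2\<bar> - (2 * \<bar>m12 / 2\<bar> + \<bar>- m12 / 2\<bar>) * 0) at_top"
      by (intro tendsto_diff tendsto_add tendsto_mult tendsto_rabs tendsto_const)
    from order_tendstoD(1)[OF this, of 0]
    have "\<forall>\<^sub>F k in at_top. 0 < 2 * \<bar>P k / k\<bar> - \<bar>R k / k\<bar> - (2 * \<bar>U k / k\<bar> + \<bar>W k / k\<bar>) * (E / k)"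
      using False by simp
    then show ?thesis
      using eventually_gt_at_top[of 0]
    proof eventually_elim
      case (elim k)
      then have eq: "2 * \<bar>P k / k\<bar> - \<bar>R k / k\<bar> - (2 * \<bar>U k / k\<bar> + \<bar>W k / k\<bar>) * (E / k) = F k / k"
        by (simp add: F_def diff_divide_distrib add_divide_distrib distrib_right)
      have "0 < F k / k"
        using elim(1) unfolding eq .
      with elim(2) show "0 < F k"
        by (simp add: zero_less_divide_iff)
    qed
  qed
  then show ?thesis
    using eventually_gt_at_top[of 0]
  proof (eventually_elim, intro allI impI)
    fix k :: real and ym ym' yp yp' :: complex
    assume k: "0 < F k" "0 < k"
      and tr: "(vector [yp, yp'] :: complex^2) =
        (\<chi> i j. complex_of_real (M $ i $ j)) *v (vector [ym, ym'] :: complex^2)"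
      and rat: "norm (yp' + k *\<^sub>R yp) \<le> E / k * norm (yp' - k *\<^sub>R yp)"
      and nz: "yp' - k *\<^sub>R yp \<noteq> 0"
    have yp: "yp = m11 *\<^sub>R ym + m12 *\<^sub>R ym'" "yp' = m21 *\<^sub>R ym + m22 *\<^sub>R ym'"
      using arg_cong[OF tr, of "\<lambda>v. v $ 1"] arg_cong[OF tr, of "\<lambda>v. v $ 2"]
      by (simp_all add: matrix_vector_mult_def sum_2 m scaleR_conv_of_real)
    define a where "a = yp' - k *\<^sub>R yp"
    define b where "b = yp' + k *\<^sub>R yp"
    have ab: "2 *\<^sub>R yp' = a + b" "(2 * k) *\<^sub>R yp = b - a"
      by (simp_all add: a_def b_def scaleR_2 scaleR_left_distrib[symmetric])
    \<comment> \<open>Inserting the determinant as a factor 1 yields the inverse matrix by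
      expansion.\<close>
    have "ym = (m11 * m22 - m12 * m21) *\<^sub>R ym" "ym' = (m11 * m22 - m12 * m21) *\<^sub>R ym'"
      by (simp_all add: det)
    then have inv: "ym = m22 *\<^sub>R yp - m12 *\<^sub>R yp'" "ym' = m11 *\<^sub>R yp' - m21 *\<^sub>R yp"
      by (simp_all add: yp algebra_simps)
    have y': "yp' = (1/2) *\<^sub>R (a + b)" "yp = (1 / (2 * k)) *\<^sub>R (b - a)"
      using k by (simp_all flip: ab)
    have "ym' - k *\<^sub>R ym = P k *\<^sub>R a + U k *\<^sub>R b"
      unfolding inv y' P_def U_def using k
      by (simp add: scaleR_conv_of_real field_simps)
    moreover have "ym' + k *\<^sub>R ym = R k *\<^sub>R a + W k *\<^sub>R b"
      unfolding inv y' R_def W_def using k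
      by (simp add: scaleR_conv_of_real field_simps)
    moreover have "norm (P k *\<^sub>R a + U k *\<^sub>R b) \<ge> \<bar>P k\<bar> * norm a - \<bar>U k\<bar> * (E / k * norm a)"
    proof -
      have "\<bar>U k\<bar> * norm b \<le> \<bar>U k\<bar> * (E / k * norm a)"
        using rat by (intro mult_left_mono) (auto simp: a_def b_def)
      then show ?thesis
        using norm_diff_ineq[of "P k *\<^sub>R a" "U k *\<^sub>R b"] by simp
    qed
    moreover have "norm (R k *\<^sub>R a + W k *\<^sub>R b) \<le> \<bar>R k\<bar> * norm a + \<bar>W k\<bar> * (E / k * norm a)"
    proof -
      have "\<bar>W k\<bar> * norm b \<le> \<bar>W k\<bar> * (E / k * norm a)"
        using rat by (intro mult_left_mono) (auto simp: a_def b_def)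
      then show ?thesis
        using norm_triangle_ineq[of "R k *\<^sub>R a" "W k *\<^sub>R b"] by simp
    qed
    moreover have "0 < F k * norm a"
      using k nz by (simp add: a_def)
    then have "\<bar>R k\<bar> * norm a + \<bar>W k\<bar> * (E / k * norm a)
        < 2 * (\<bar>P k\<bar> * norm a - \<bar>U k\<bar> * (E / k * norm a))"
      by (simp add: F_def algebra_simps)
    ultimately show "norm (ym' + k *\<^sub>R ym) < 2 * norm (ym' - k *\<^sub>R ym)"
      by simp
  qed
qed

text \<open>The dichotomy is applied on \<open>{x..S}\<close> with \<open>x\<close> tending to 0
  from the right, the limits are carried through the transfer condition, and the dichotomy is
  applied again on \<open>{-S..c}\<close> with \<open>c\<close> slightly below 0. The constant
  \<open>E\<close> depends neither on \<open>k\<close> nor on the data at \<open>S\<close>.\<close>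

lemma transfer_solution_mode_ratio:
  fixes M :: "real^2^2" and S :: real and q :: "real \<Rightarrow> real"
  assumes "S > 0" "det M = 1" and q: "(\<lambda>t. 1 + (q t)\<^sup>2) integrable_on {-S..S}"
  obtains E where "0 \<le> E" "\<forall>\<^sub>F k in at_top. \<forall>y y' :: real \<Rightarrow> complex.
     transfer_solution S q M (complex_of_real (- (k\<^sup>2))) y y' \<longrightarrow>
     norm (y' S + k *\<^sub>R y S) \<le> 2 * norm (y' S - k *\<^sub>R y S) \<longrightarrow> y' S - k *\<^sub>R y S \<noteq> 0 \<longrightarrow>
     norm (y' (-S) + k *\<^sub>R y (-S)) \<le> E / k * norm (y' (-S) - k *\<^sub>R y (-S)) \<and>
     y' (-S) - k *\<^sub>R y (-S) \<noteq> 0"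
proof -
  define Q where "Q = integral {-S..S} (\<lambda>t. 1 + (q t)\<^sup>2)"
  \<comment> \<open>The dichotomy constant for \<open>d = S / 2\<close>: both intervals used below
    have at least this length, and \<open>Q\<close> bounds the integral over either.\<close>
  define E where "E = 2 / (S / 2) + 8 * Q"
  have Q: "(\<lambda>t. 1 + (q t)\<^sup>2) integrable_on {u..v}" "integral {u..v} (\<lambda>t. 1 + (q t)\<^sup>2) \<le> Q"
    if "{u..v} \<subseteq> {-S..S}" for u v
  proof -
    show int: "(\<lambda>t. 1 + (q t)\<^sup>2) integrable_on {u..v}"
      using q that by (rule integrable_on_subinterval)
    show "integral {u..v} (\<lambda>t. 1 + (q t)\<^sup>2) \<le> Q"
      unfolding Q_def by (intro integral_subset_le int that q) auto
  qed
  have "0 \<le> Q"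
    unfolding Q_def by (intro integral_nonneg q) auto
  then have "0 \<le> E"
    using \<open>S > 0\<close> by (simp add: E_def)
  moreover have "\<forall>\<^sub>F k in at_top. \<forall>y y' :: real \<Rightarrow> complex.
     transfer_solution S q M (complex_of_real (- (k\<^sup>2))) y y' \<longrightarrow>
     norm (y' S + k *\<^sub>R y S) \<le> 2 * norm (y' S - k *\<^sub>R y S) \<longrightarrow> y' S - k *\<^sub>R y S \<noteq> 0 \<longrightarrow>
     norm (y' (-S) + k *\<^sub>R y (-S)) \<le> E / k * norm (y' (-S) - k *\<^sub>R y (-S)) \<and>
     y' (-S) - k *\<^sub>R y (-S) \<noteq> 0"
    using transfer_keeps_mode_ratio[OF \<open>det M = 1\<close>, of E] eventually_gt_at_top[of 0]
      eventually_ge_at_top[of "8 * Q"]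
  proof (eventually_elim, intro allI impI)
    fix k :: real and y y' :: "real \<Rightarrow> complex"
    assume keep: "\<forall>ym ym' yp yp' :: complex.
     (vector [yp, yp'] :: complex^2) =
        (\<chi> i j. complex_of_real (M $ i $ j)) *v (vector [ym, ym'] :: complex^2) \<longrightarrow>
     norm (yp' + k *\<^sub>R yp) \<le> E / k * norm (yp' - k *\<^sub>R yp) \<longrightarrow> yp' - k *\<^sub>R yp \<noteq> 0 \<longrightarrow>
     norm (ym' + k *\<^sub>R ym) < 2 * norm (ym' - k *\<^sub>R ym)"
      and k: "0 < k" "8 * Q \<le> k"
      and sol: "transfer_solution S q M (complex_of_real (- (k\<^sup>2))) y y'"
      and ini: "norm (y' S + k *\<^sub>R y S) \<le> 2 * norm (y' S - k *\<^sub>R y S)" "y' S - k *\<^sub>R y S \<noteq> 0"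
    define a where "a = (\<lambda>t. y' t - k *\<^sub>R y t)"
    define b where "b = (\<lambda>t. y' t + k *\<^sub>R y t)"
    have iniS: "norm (b S) \<le> 2 * norm (a S)" "a S \<noteq> 0"
      using ini by (auto simp: a_def b_def)
    obtain ym ym' yp yp' where
      solm: "sl_solution_on {-S..<0} q (complex_of_real (- (k\<^sup>2))) y y'" and
      solp: "sl_solution_on {0<..S} q (complex_of_real (- (k\<^sup>2))) y y'" and
      lim: "(y \<longlongrightarrow> ym) (at_left 0)" "(y' \<longlongrightarrow> ym') (at_left 0)"
        "(y \<longlongrightarrow> yp) (at_right 0)" "(y' \<longlongrightarrow> yp') (at_right 0)" and
      tr: "(vector [yp, yp'] :: complex^2) =
          (\<chi> i j. complex_of_real (M $ i $ j)) *v (vector [ym, ym'] :: complex^2)"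
      using sol unfolding transfer_solution_def by blast
    have right: "norm (a S) / 2 \<le> norm (a x)" "norm (b x) \<le> E / k * norm (a x)"
      if x: "0 < x" "x < S / 2" for x
    proof -
      have "{x..S} \<subseteq> {0<..S}" "S / 2 \<le> S - x" "{x..S} \<subseteq> {-S..S}"
        using x \<open>S > 0\<close> by auto
      from sl_mode_dichotomy[OF solp this(1) _ this(2) k Q[OF this(3)]] iniS \<open>S > 0\<close>
      show "norm (a S) / 2 \<le> norm (a x)" "norm (b x) \<le> E / k * norm (a x)"
        by (simp_all add: a_def b_def E_def)
    qed
    have ev: "\<forall>\<^sub>F x in at_right 0. 0 < x \<and> x < S / 2"
      using eventually_at_right_real[of 0 "S / 2"] \<open>S > 0\<close> by (auto elim: eventually_mono)
    have lima: "(a \<longlongrightarrow> yp' - k *\<^sub>R yp) (at_right 0)" and limb: "(b \<longlongrightarrow> yp' + k *\<^sub>R yp) (at_right 0)"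
      unfolding a_def b_def by (intro tendsto_intros lim)+
    \<comment> \<open>The lower bound is uniform in \<open>x\<close>, so the growing mode cannot
      vanish in the limit.\<close>
    have "norm (a S) / 2 \<le> norm (yp' - k *\<^sub>R yp)"
    proof (rule tendsto_lowerbound[OF tendsto_norm[OF lima]])
      show "\<forall>\<^sub>F x in at_right 0. norm (a S) / 2 \<le> norm (a x)"
        using ev by eventually_elim (use right in blast)
    qed simp
    then have nz: "yp' - k *\<^sub>R yp \<noteq> 0"
      using iniS by auto
    have "norm (yp' + k *\<^sub>R yp) \<le> E / k * norm (yp' - k *\<^sub>R yp)"
    proof (rule tendsto_le[OF _ tendsto_mult[OF tendsto_const tendsto_norm[OF lima]] tendsto_norm[OF limb]])
      show "\<forall>\<^sub>F x in at_right 0. norm (b x) \<le> E / k * norm (a x)"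
        using ev by eventually_elim (use right in blast)
    qed simp
    from keep[rule_format, OF tr this nz]
    have less: "norm (ym' + k *\<^sub>R ym) < 2 * norm (ym' - k *\<^sub>R ym)" .
    \<comment> \<open>Strictness of the inequality between the limits makes it hold at actual points
      \<open>c < 0\<close>, where the solution is defined on a closed interval.\<close>
    have "((\<lambda>x. 2 * norm (a x) - norm (b x)) \<longlongrightarrow> 2 * norm (ym' - k *\<^sub>R ym) - norm (ym' + k *\<^sub>R ym)) (at_left 0)"
      unfolding a_def b_def by (intro tendsto_intros lim)
    from order_tendstoD(1)[OF this, of 0] less
    have "\<forall>\<^sub>F x in at_left 0. 0 < 2 * norm (a x) - norm (b x)"
      by simp
    moreover have "\<forall>\<^sub>F x in at_left 0. x \<in> {- (S / 2)<..<0}"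
      using \<open>S > 0\<close> by (intro eventually_at_left_real) auto
    ultimately have "\<forall>\<^sub>F x in at_left 0. 0 < 2 * norm (a x) - norm (b x) \<and> x \<in> {- (S / 2)<..<0}"
      by (rule eventually_conj)
    from eventually_happens[OF this]
    obtain c where c: "norm (b c) < 2 * norm (a c)" "- (S / 2) < c" "c < 0"
      by auto
    have "{-S..c} \<subseteq> {-S..<0}" "S / 2 \<le> c - (-S)" "{-S..c} \<subseteq> {-S..S}"
      using c \<open>S > 0\<close> by auto
    from sl_mode_dichotomy[OF solm this(1) _ this(2) k Q[OF this(3)]] c \<open>S > 0\<close>
    have left: "norm (a c) / 2 \<le> norm (a (-S))" "norm (b (-S)) \<le> E / k * norm (a (-S))"
      by (simp_all add: a_def b_def E_def)
    have "a c \<noteq> 0"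
      using c norm_ge_zero[of "b c"] by auto
    with left show "norm (y' (-S) + k *\<^sub>R y (-S)) \<le> E / k * norm (y' (-S) - k *\<^sub>R y (-S)) \<and>
     y' (-S) - k *\<^sub>R y (-S) \<noteq> 0"
      unfolding a_def b_def by auto
  qed
  ultimately show ?thesis
    by (rule that)
qed

text \<open>For \<beta> below \<pi> the sine is positive and dominates for large \<open>k\<close>,
  with ratio tending to 1; the bound 2 then amounts to
  \<open>3 * cos \<beta> \<le> k * sin \<beta>\<close>. For \<beta> equal to \<pi> both sums equal
  -1.\<close>

lemma initial_mode_ratio:
  fixes \<beta> :: real
  assumes "0 < \<beta>" "\<beta> \<le> pi"
  shows "\<forall>\<^sub>F k in at_top. \<bar>cos \<beta> + k * sin \<beta>\<bar> \<le> 2 * \<bar>cos \<beta> - k * sin \<beta>\<bar> \<and> cos \<beta> - k * sin \<beta> \<noteq> 0"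
proof (cases "\<beta> = pi")
  case False
  then have s: "sin \<beta> > 0"
    using assms by (intro sin_gt_zero) auto
  show ?thesis
    using eventually_ge_at_top[of "3 / sin \<beta>"]
  proof eventually_elim
    case (elim k)
    then have "3 \<le> k * sin \<beta>"
      using s by (simp add: field_simps)
    then have "0 \<le> cos \<beta> + k * sin \<beta>" "cos \<beta> - k * sin \<beta> < 0" "3 * cos \<beta> \<le> k * sin \<beta>"
      using cos_le_one[of \<beta>] cos_ge_minus_one[of \<beta>] by linarith+
    then show ?case
      by simp
  qed
qed simp

section \<open>Asymptotics of the m-function\<close>

text \<open>Substitution of \<open>k = sqrt (- l)\<close>, which tends to infinity as
  \<open>l\<close> tends to minus infinity.\<close>

lemma bigo_at_bot_sqrtI:
  fixes f :: "real \<Rightarrow> complex" and g :: "real \<Rightarrow> complex"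
  assumes "\<forall>\<^sub>F k in at_top. norm (f (- (k\<^sup>2))) \<le> C * norm (g (- (k\<^sup>2)))"
  shows "f \<in> O[at_bot](g)"
proof (rule bigoI)
  have "filterlim (\<lambda>l::real. sqrt (- l)) at_top at_bot"
    by real_asymp
  then have "\<forall>\<^sub>F l in at_bot. norm (f (- ((sqrt (- l))\<^sup>2))) \<le> C * norm (g (- ((sqrt (- l))\<^sup>2)))"
    using assms by (rule eventually_compose_filterlim[rotated])
  then show "\<forall>\<^sub>F l in at_bot. norm (f l) \<le> C * norm (g l)"
    using eventually_le_at_bot[of 0] by eventually_elim simp
qed

text \<open>The principal branch takes the root with nonnegative imaginary part on the negative
  axis, so the leading term \<open>- \<i> * csqrt l\<close> is \<open>k\<close>.\<close>

lemma csqrt_minus_square: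
  assumes "k \<ge> 0"
  shows "csqrt (complex_of_real (- (k\<^sup>2))) = \<i> * complex_of_real k"
  using assms csqrt_of_real_nonpos[of "- (k\<^sup>2)"] by simp

theorem theorem2p5:
  fixes S \<alpha> \<beta> :: real and q :: "real \<Rightarrow> real" and M :: "real^2^2"
    and v v' :: "real \<Rightarrow> complex \<Rightarrow> complex"
  assumes "S > 0"
    and "q \<in> borel_measurable (lebesgue_on {-S..S})"
    and "integrable (lebesgue_on {-S..S}) (\<lambda>x. (q x)\<^sup>2)"
    and "det M = 1"
    and "0 \<le> \<alpha>" and "\<alpha> < pi" and "0 < \<beta>" and "\<beta> \<le> pi"
    and "is_v_beta S q M \<beta> v v'"
  shows "(\<alpha> = 0 \<longrightarrow>
           (\<lambda>l::real. titchmarsh_weyl_m S \<alpha> v v' (complex_of_real l)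
                        - (- \<i> * csqrt (complex_of_real l))) \<in> O[at_bot](\<lambda>_. 1)) \<and>
         (\<alpha> \<noteq> 0 \<longrightarrow>
           (\<lambda>l::real. titchmarsh_weyl_m S \<alpha> v v' (complex_of_real l)
                        - complex_of_real (cot \<alpha>)) \<in> O[at_bot](\<lambda>l. 1 / csqrt (complex_of_real l)))"
proof -
  have "(\<lambda>x. (q x)\<^sup>2) integrable_on {-S..S}"
    using assms(3) by (rule integrable_on_lebesgue_on) simp
  then have int: "(\<lambda>t. 1 + (q t)\<^sup>2) integrable_on {-S..S}"
    by (intro integrable_add) auto
  obtain E where "0 \<le> E" and E: "\<forall>\<^sub>F k in at_top. \<forall>y y' :: real \<Rightarrow> complex.
     transfer_solution S q M (complex_of_real (- (k\<^sup>2))) y y' \<longrightarrow>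
     norm (y' S + k *\<^sub>R y S) \<le> 2 * norm (y' S - k *\<^sub>R y S) \<longrightarrow> y' S - k *\<^sub>R y S \<noteq> 0 \<longrightarrow>
     norm (y' (-S) + k *\<^sub>R y (-S)) \<le> E / k * norm (y' (-S) - k *\<^sub>R y (-S)) \<and>
     y' (-S) - k *\<^sub>R y (-S) \<noteq> 0"
    by (rule transfer_solution_mode_ratio[OF assms(1,4) int])
  define Y where "Y k = v (-S) (complex_of_real (- (k\<^sup>2)))" for k :: real
  define Y' where "Y' k = v' (-S) (complex_of_real (- (k\<^sup>2)))" for k :: real
  define a where "a k = Y' k - k *\<^sub>R Y k" for k
  define b where "b k = Y' k + k *\<^sub>R Y k" for k
  have ab: "\<forall>\<^sub>F k in at_top. norm (b k) \<le> E / k * norm (a k) \<and> a k \<noteq> 0"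
    using E initial_mode_ratio[OF assms(7,8)]
  proof eventually_elim
    case (elim k)
    let ?l = "complex_of_real (- (k\<^sup>2))"
    have v: "transfer_solution S q M ?l (\<lambda>x. v x ?l) (\<lambda>x. v' x ?l)"
      "v S ?l = complex_of_real (sin \<beta>)" "v' S ?l = complex_of_real (cos \<beta>)"
      using assms(9) unfolding is_v_beta_def by blast+
    have r: "v' S ?l + k *\<^sub>R v S ?l = complex_of_real (cos \<beta> + k * sin \<beta>)"
      "v' S ?l - k *\<^sub>R v S ?l = complex_of_real (cos \<beta> - k * sin \<beta>)"
      unfolding v by (simp_all add: scaleR_conv_of_real)
    have "norm (v' S ?l + k *\<^sub>R v S ?l) \<le> 2 * norm (v' S ?l - k *\<^sub>R v S ?l)"
      "v' S ?l - k *\<^sub>R v S ?l \<noteq> 0"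
      unfolding r norm_of_real of_real_eq_0_iff using elim by auto
    with elim(1) v(1) show ?case
      unfolding a_def b_def Y_def Y'_def by blast
  qed
  have Ek: "\<forall>\<^sub>F k in at_top. E / k \<le> 1 / 2 \<and> 0 < k"
    \<comment> \<open>The summand 1 makes \<open>k\<close> positive even if
      \<open>E = 0\<close>.\<close>
    using eventually_ge_at_top[of "2 * E + 1"]
  proof eventually_elim
    case (elim k)
    with \<open>0 \<le> E\<close> show ?case
      by (auto simp: field_simps)
  qed
  have Yab: "(2 * k) *\<^sub>R Y k = b k - a k" "2 *\<^sub>R Y' k = a k + b k" for k
    by (simp_all add: a_def b_def scaleR_2 scaleR_left_distrib[symmetric])
  have small_b: "\<forall>\<^sub>F k in at_top. norm (b k) \<le> norm (a k) / 2"
    using ab Ek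
  proof eventually_elim
    case (elim k)
    have "E / k * norm (a k) \<le> 1 / 2 * norm (a k)"
      using elim by (intro mult_right_mono) auto
    with elim show ?case
      by linarith
  qed
  show ?thesis
  proof (intro conjI impI)
    assume "\<alpha> = 0"
    show "(\<lambda>l::real. titchmarsh_weyl_m S \<alpha> v v' (complex_of_real l)
                        - (- \<i> * csqrt (complex_of_real l))) \<in> O[at_bot](\<lambda>_. 1)"
    \<comment> \<open>The difference equals \<open>2 * k * b k / (a k - b k)\<close>, where the
      numerator is at most \<open>2 * E * norm (a k)\<close> and the denominator at least
      \<open>norm (a k) / 2\<close> in norm.\<close>
    proof (rule bigo_at_bot_sqrtI[where C = "4 * E"])
      show "\<forall>\<^sub>F k in at_top. norm (titchmarsh_weyl_m S \<alpha> v v' (complex_of_real (- (k\<^sup>2)))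
          - (- \<i> * csqrt (complex_of_real (- (k\<^sup>2))))) \<le> 4 * E * norm (1::complex)"
        using ab Ek small_b
      proof eventually_elim
        case (elim k)
        have k: "k > 0"
          using elim by auto
        have "norm (a k) / 2 \<le> norm (a k - b k)"
          using elim norm_triangle_ineq2[of "a k" "b k"] by linarith
        then have nz: "a k - b k \<noteq> 0" "norm (a k) > 0"
          using elim by auto
        have Y: "Y k = (b k - a k) / (2 * k)" "Y' k = (a k + b k) / 2"
          using Yab[of k] k by (auto simp: scaleR_conv_of_real field_simps)
        have "titchmarsh_weyl_m S \<alpha> v v' (complex_of_real (- (k\<^sup>2)))
          - (- \<i> * csqrt (complex_of_real (- (k\<^sup>2)))) = - (Y' k / Y k) - k"
          unfolding csqrt_minus_square[OF less_imp_le[OF k]] titchmarsh_weyl_m_def char_det_def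
          by (simp add: \<open>\<alpha> = 0\<close> Y_def Y'_def)
        also have "\<dots> = 2 * k * b k / (a k - b k)"
          unfolding Y using nz k by (simp add: divide_simps) (simp add: algebra_simps)
        also have "norm \<dots> = 2 * k * norm (b k) / norm (a k - b k)"
          using k by (simp add: norm_mult norm_divide)
        also have "\<dots> \<le> 2 * k * (E / k * norm (a k)) / (norm (a k) / 2)"
          using elim k nz \<open>0 \<le> E\<close> \<open>norm (a k) / 2 \<le> norm (a k - b k)\<close>
          by (intro frac_le mult_left_mono) auto
        also have "\<dots> = 4 * E * norm (1::complex)"
          using k nz by simp
        finally show ?case .
      qed
    qed
  next
    assume "\<alpha> \<noteq> 0"
    then have s: "sin \<alpha> > 0"
      using assms by (intro sin_gt_zero) auto
    show "(\<lambda>l::real. titchmarsh_weyl_m S \<alpha> v v' (complex_of_real l)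
                        - complex_of_real (cot \<alpha>)) \<in> O[at_bot](\<lambda>l. 1 / csqrt (complex_of_real l))"
    \<comment> \<open>The difference equals \<open>Y k / (D * sin \<alpha>)\<close>, with
      \<open>norm (Y k) \<le> norm (a k) / k\<close> and
      \<open>norm D \<ge> norm (a k) * sin \<alpha> / 8\<close>.\<close>
    proof (rule bigo_at_bot_sqrtI[where C = "8 / (sin \<alpha> * sin \<alpha>)"])
      show "\<forall>\<^sub>F k in at_top. norm (titchmarsh_weyl_m S \<alpha> v v' (complex_of_real (- (k\<^sup>2)))
          - complex_of_real (cot \<alpha>)) \<le> 8 / (sin \<alpha> * sin \<alpha>) * norm (1 / csqrt (complex_of_real (- (k\<^sup>2))))"
        using ab Ek small_b eventually_ge_at_top[of "8 / sin \<alpha>"]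
      proof eventually_elim
        case (elim k)
        have k: "k > 0" and na: "norm (a k) > 0"
          using elim by auto
        have "2 * k * norm (Y k) = norm (b k - a k)"
          using arg_cong[OF Yab(1)[of k], of norm] k by simp
        also have "\<dots> \<le> 2 * norm (a k)"
          using elim norm_triangle_ineq4[of "b k" "a k"] norm_ge_zero[of "a k"] by linarith
        finally have Y: "norm (Y k) \<le> norm (a k) / k"
          using k by (simp add: field_simps)
        have "2 * norm (Y' k) = norm (a k + b k)"
          using arg_cong[OF Yab(2)[of k], of norm] by simp
        then have Y': "norm (a k) / 4 \<le> norm (Y' k)"
          using elim norm_diff_ineq[of "a k" "b k"] by linarith
        define D where "D = Y' k * complex_of_real (sin \<alpha>) - Y k * complex_of_real (cos \<alpha>)"
        \<comment> \<open>The \<open>Y'\<close> term of \<open>D\<close> is at least twice this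
          size; the threshold \<open>8 / sin \<alpha>\<close> for \<open>k\<close> keeps the
          \<open>Y\<close> term below half of that.\<close>
        have "norm (a k) * sin \<alpha> / 8 \<le> norm D"
        proof -
          have "norm (a k) / 4 * sin \<alpha> \<le> norm (Y' k) * sin \<alpha>"
            using Y' s by (intro mult_right_mono) auto
          moreover have "norm (Y k) * \<bar>cos \<alpha>\<bar> \<le> norm (a k) / k * 1"
            using Y k by (intro mult_mono) auto
          moreover have "norm (a k) / k \<le> norm (a k) * sin \<alpha> / 8"
          proof -
            have "8 \<le> k * sin \<alpha>"
              using elim s by (simp add: field_simps)
            then have "norm (a k) * 8 \<le> norm (a k) * (k * sin \<alpha>)"
              by (intro mult_left_mono) auto
            then show ?thesis
              using k by (simp add: field_simps)
          qed
          moreover have "norm (Y' k) * sin \<alpha> - norm (Y k) * \<bar>cos \<alpha>\<bar> \<le> norm D"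
            using norm_triangle_ineq2[of "Y' k * complex_of_real (sin \<alpha>)" "Y k * complex_of_real (cos \<alpha>)"] s
            by (simp only: D_def norm_mult norm_of_real)
          ultimately show ?thesis
            by linarith
        qed
        then have D: "0 < norm (a k) * sin \<alpha> / 8" "norm (a k) * sin \<alpha> / 8 \<le> norm D" "D \<noteq> 0"
          using na s by (auto simp: mult_le_0_iff)
        let ?s = "complex_of_real (sin \<alpha>)" and ?c = "complex_of_real (cos \<alpha>)"
        have sc: "?s * ?s + ?c * ?c = 1"
          by (metis of_real_add of_real_mult of_real_1 power2_eq_square sin_cos_squared_add)
        have s0: "?s \<noteq> 0"
          using s by simp
        have "titchmarsh_weyl_m S \<alpha> v v' (complex_of_real (- (k\<^sup>2))) - complex_of_real (cot \<alpha>)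
            = (Y k * ?s + Y' k * ?c) / D - ?c / ?s"
          by (simp add: titchmarsh_weyl_m_def char_det_def Y_def Y'_def D_def cot_def)
        also have "\<dots> = ((Y k * ?s + Y' k * ?c) * ?s - ?c * D) / (D * ?s)"
          using D(3) s0 by (rule diff_frac_eq)
        \<comment> \<open>The \<open>Y'\<close> terms cancel, which is why the cotangent is the
          exact limit.\<close>
        also have "(Y k * ?s + Y' k * ?c) * ?s - ?c * D = Y k * (?s * ?s + ?c * ?c)"
          by (simp add: D_def algebra_simps)
        also have "\<dots> = Y k"
          by (simp only: sc mult_1_right)
        also have "norm (Y k / (D * ?s)) = norm (Y k) / (norm D * sin \<alpha>)"
          using s by (simp only: norm_mult norm_divide norm_of_real)
        also have "\<dots> \<le> (norm (a k) / k) / (norm (a k) * sin \<alpha> / 8 * sin \<alpha>)"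
          using D Y s k by (intro frac_le mult_right_mono) auto
        also have "\<dots> = 8 / (sin \<alpha> * sin \<alpha>) * (1 / k)"
          using na k s by (simp add: field_simps)
        also have "1 / k = norm (1 / csqrt (complex_of_real (- (k\<^sup>2))))"
          unfolding csqrt_minus_square[OF less_imp_le[OF k]] using k by (simp add: norm_mult norm_divide)
        finally show ?case .
      qed
    qed
  qed
qed

end
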